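(* Let a plane curve $r(\theta)$, parametrized by its angle of inclination $\theta$ in an open interval $I$, have signed radius of curvature $R=R(\theta)$ (smooth on $I$), and let rays at each point be tilted at angle $\phi=\phi(\theta)$ (smooth on $I$) to the normal of the curve, where $\phi'(\theta)\neq 1$ for all $\theta\in I$. Then the angle of inclination of the caustic of these rays at its point of tangency with the ray corresponding to $\theta$ is $\theta_1=\theta+\frac{\pi}{2}-\phi$, and the signed radius of curvature of the caustic at this point is $$R_1=\frac{1}{(1-\phi')^2}\left(\left((1-2\phi')\sin\phi+\frac{\phi''}{1-\phi'}\cos\phi\right)R+\cos\phi\,R'\right),$$ where primes denote derivatives with respect to $\theta$.
   Context: Curves in the plane may have cusps (points where the velocity reverses direction). The angle of inclination $\theta$ is the angle of the tangent of the curve with the $x$-axis, and curves are parametrized by $\theta$, which strictly increases along the curve. The unit tangent is $T(\theta)=(\cos\theta,\sin\theta)$, the unit normal is $N(\theta)=(-\sin\theta,\cos\theta)$, and the signed radius of curvature $R(\theta)$ (negative values and sign changes at cusps are allowed) is defined by $\frac{dr}{d\theta}=R(\theta)\,T(\theta)$. Equivalently, $R=ds/d\theta$ for the signed parameter $s$ with $dr/ds=T$. Tilting angle: the ray at the point $r(\theta)$ is the line through $r(\theta)$ with unit direction $\nu(\theta)=\sin\phi(\theta)\,T(\theta)+\cos\phi(\theta)\,N(\theta)$; $\phi$ is the angle between $\nu$ and $N$, with positive tilt in the direction of $T$. Caustic: the caustic is the envelope of the family of rays, i.e. the curve of points $c(\theta)=r(\theta)+t\,\nu(\theta)$, with $t=t(\theta)$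 determined by the condition that $\frac{\partial}{\partial\theta}(r(\theta)+t\nu(\theta))$ (with $t$ fixed) and $\frac{\partial}{\partial t}(r(\theta)+t\nu(\theta))=\nu(\theta)$ are collinear. The caustic's angle of inclination $\theta_1$ is that of the unit tangent $T_1=(\cos\theta_1,\sin\theta_1)=\nu$, and its signed radius of curvature $R_1$ is defined by $\frac{dc}{d\theta_1}=R_1\,T_1$. *)

theory Defs
  imports "HOL-Analysis.Analysis"
begin

definition smooth_on :: "real set \<Rightarrow> (real \<Rightarrow> real) \<Rightarrow> bool" where
  "smooth_on S f \<longleftrightarrow> (\<forall>k. \<forall>x\<in>S. ((deriv ^^ k) f) differentiable (at x))"

definition unit_tangent :: "real \<Rightarrow> real \<times> real" where
  "unit_tangent \<theta> = (cos \<theta>, sin \<theta>)"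

definition unit_normal :: "real \<Rightarrow> real \<times> real" where
  "unit_normal \<theta> = (- sin \<theta>, cos \<theta>)"

definition ray_direction :: "(real \<Rightarrow> real) \<Rightarrow> real \<Rightarrow> real \<times> real" where
  "ray_direction \<phi> \<theta> = sin (\<phi> \<theta>) *\<^sub>R unit_tangent \<theta> + cos (\<phi> \<theta>) *\<^sub>R unit_normal \<theta>"

(* Two vectors u, v are collinear iff the points 0, u, v lie on a line. *)
definition envelope_condition ::
    "(real \<Rightarrow> real \<times> real) \<Rightarrow> (real \<Rightarrow> real \<times> real) \<Rightarrow> real \<Rightarrow> real \<Rightarrow> bool" where
  "envelope_condition r \<nu> \<theta> t \<longleftrightarrow>
     collinear {0, vector_derivative (\<lambda>x. r x + t *\<^sub>R \<nu> x) (at \<theta>),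
                   vector_derivative (\<lambda>s. r \<theta> + s *\<^sub>R \<nu> \<theta>) (at t)}"

(* Meaningful only where exactly one t satisfies the envelope condition. *)
definition caustic ::
    "(real \<Rightarrow> real \<times> real) \<Rightarrow> (real \<Rightarrow> real \<times> real) \<Rightarrow> real \<Rightarrow> real \<times> real" where
  "caustic r \<nu> \<theta> = r \<theta> + (THE t. envelope_condition r \<nu> \<theta> t) *\<^sub>R \<nu> \<theta>"

(* An angle of inclination of a unit vector; it is determined up to multiples of 2 pi. *)
definition is_inclination :: "real \<Rightarrow> real \<times> real \<Rightarrow> bool" where
  "is_inclination \<alpha> v \<longleftrightarrow> unit_tangent \<alpha> = v"

(* The curve c, given with a parameter x in S, is reparametrized by its angle of inclination
   \<psi> x; the radius \<rho> x at the point c x is then defined by dc/d\<psi> = \<rho> T(\<psi>). The derivative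
   is two-sided, so \<psi> ` S is meant to be open. *)
definition has_signed_radius_on ::
    "(real \<Rightarrow> real \<times> real) \<Rightarrow> (real \<Rightarrow> real) \<Rightarrow> (real \<Rightarrow> real) \<Rightarrow> real set \<Rightarrow> bool" where
  "has_signed_radius_on c \<psi> \<rho> S \<longleftrightarrow>
     inj_on \<psi> S \<and>
     (\<forall>x\<in>S. ((c \<circ> inv_into S \<psi>) has_vector_derivative \<rho> x *\<^sub>R unit_tangent (\<psi> x)) (at (\<psi> x)))"

end

(* Write psi = theta + pi/2 - phi. The ray direction is the unit tangent T(psi), whose derivative
   is (1 - phi') N(psi). Since T(theta) = sin phi T(psi) - cos phi N(psi), the derivative of
   r + t T(psi) for fixed t is tangent to the ray iff t = R cos phi / (1 - phi'). With this t the
   caustic c satisfies dc/dtheta = (R sin phi + t') T(psi); dividing by dpsi/dtheta = 1 - phi'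
   gives the radius. *)
theory Submission
  imports Defs
begin

text \<open>T(a) and N(a) form an orthonormal frame, so a vector is a multiple of T(a) exactly when
  its component along N(a) vanishes. This turns the envelope condition into a scalar
  equation.\<close>

lemma collinear_unit_tangent_iff:
  "collinear {0, u, unit_tangent a} \<longleftrightarrow> u \<bullet> unit_normal a = 0"
proof
  assume "collinear {0, u, unit_tangent a}"
  then have "collinear {0, unit_tangent a, u}"
    by (simp add: insert_commute)
  moreover have "unit_tangent a \<noteq> 0"
    using sin_zero_abs_cos_one[of a] by (auto simp: unit_tangent_def zero_prod_def)
  ultimately obtain c where "u = c *\<^sub>R unit_tangent a"
    unfolding collinear_lemma by force
  then show "u \<bullet> unit_normal a = 0"
    by (simp add: unit_tangent_def unit_normal_def)
next
  assume eq: "u \<bullet> unit_normal a = 0"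
  obtain x y where u: "u = (x, y)" by (cases u)
  have s: "sin a * sin a + cos a * cos a = 1"
    using sin_cos_squared_add[of a] by (simp add: power2_eq_square)
  have e: "x * sin a = y * cos a"
    using eq by (simp add: u unit_normal_def)
  \<comment> \<open>The factor \<open>x * cos a + y * sin a\<close> is the component of
    \<open>u\<close> along T(a).\<close>
  have "x = (x * cos a + y * sin a) * cos a" "y = (x * cos a + y * sin a) * sin a"
    using s e by algebra+
  then have "u = (x * cos a + y * sin a) *\<^sub>R unit_tangent a"
    by (simp add: u unit_tangent_def)
  then have "collinear {0, unit_tangent a, u}"
    unfolding collinear_lemma by blast
  then show "collinear {0, u, unit_tangent a}"
    by (simp add: insert_commute)
qed

text \<open>N(\<theta>) is T(\<theta> + pi/2), and tilting it towards T(\<theta>) by \<phi> is a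
  clockwise rotation, which lowers its angle by \<phi>.\<close>

lemma ray_direction_eq: "ray_direction \<phi> \<theta> = unit_tangent (\<theta> + pi / 2 - \<phi> \<theta>)"
proof -
  have "\<theta> + pi / 2 - \<phi> \<theta> = (\<theta> - \<phi> \<theta>) + pi / 2" by simp
  then show ?thesis
    unfolding ray_direction_def unit_tangent_def unit_normal_def
    by (simp only: cos_add sin_add) (simp add: sin_diff cos_diff algebra_simps)
qed

text \<open>With \<psi> = \<theta> + pi/2 - p, the components of T(\<theta>) along T(\<psi>) and
  N(\<psi>) are cos(\<theta> - \<psi>) = sin p and sin(\<theta> - \<psi>) = -cos p.\<close>

lemma unit_tangent_eq_ray_frame:
  "unit_tangent \<theta> =
     sin p *\<^sub>R unit_tangent (\<theta> + pi / 2 - p) - cos p *\<^sub>R unit_normal (\<theta> + pi / 2 - p)"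
proof -
  have "\<theta> + pi / 2 - p = (\<theta> - p) + pi / 2" by simp
  then show ?thesis
    \<comment> \<open>The instances at \<open>-p\<close> express the sine and cosine of \<theta>
      through the angles \<theta> - p and p.\<close>
    using sin_cos_squared_add[of p] sin_diff[of "\<theta> - p" "-p"] cos_diff[of "\<theta> - p" "-p"]
    unfolding unit_tangent_def unit_normal_def
    by (simp only: cos_add sin_add) (simp add: algebra_simps)
qed

lemma unit_normal_inner [simp]:
  "unit_tangent a \<bullet> unit_normal a = 0" "unit_normal a \<bullet> unit_normal a = 1"
  using sin_cos_squared_add[of a]
  by (simp_all add: unit_tangent_def unit_normal_def power2_eq_square)

lemma has_vector_derivative_unit_tangent:
  assumes "(f has_real_derivative d) (at x)"
  shows "((\<lambda>x. unit_tangent (f x)) has_vector_derivative d *\<^sub>R unit_normal (f x)) (at x)"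
proof -
  have "((\<lambda>x. cos (f x)) has_real_derivative - sin (f x) * d) (at x)"
    "((\<lambda>x. sin (f x)) has_real_derivative cos (f x) * d) (at x)"
    using assms by (auto intro!: derivative_eq_intros)
  then have "((\<lambda>x. (cos (f x), sin (f x))) has_vector_derivative (- sin (f x) * d, cos (f x) * d)) (at x)"
    unfolding has_real_derivative_iff_has_vector_derivative
    by (rule has_vector_derivative_Pair)
  then show ?thesis
    by (simp add: unit_tangent_def unit_normal_def mult.commute)
qed

text \<open>By the mean value theorem, two equal values of \<open>f\<close> would force a zero of
  \<open>f'\<close> between their arguments, and an interval contains that point.\<close>

lemma inj_on_nonzero_deriv:
  fixes f :: "real \<Rightarrow> real"
  assumes "is_interval S"
    and D: "\<And>x. x \<in> S \<Longrightarrow> (f has_real_derivative f' x) (at x)"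
    and nz: "\<And>x. x \<in> S \<Longrightarrow> f' x \<noteq> 0"
  shows "inj_on f S"
proof (rule linorder_inj_onI)
  fix x y assume xy: "x < y" "x \<in> S" "y \<in> S"
  have sub: "z \<in> S" if "x \<le> z" "z \<le> y" for z
    using that xy \<open>is_interval S\<close> unfolding is_interval_1 by blast
  obtain z where "x < z" "z < y" "f y - f x = (y - x) * f' z"
    using MVT2[OF \<open>x < y\<close>, of f f'] D sub by blast
  then show "f x \<noteq> f y"
    using nz[OF sub[of z]] xy by auto
qed auto

text \<open>The radius can be read off in the original parameter: the inverse function theorem makes
  the inverse of \<psi> differentiable, and the chain rule then divides the velocity of
  \<open>c\<close> by \<psi>'.\<close>

lemma has_signed_radius_onI:
  fixes c :: "real \<Rightarrow> real \<times> real"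
  assumes "open S" "is_interval S"
    and \<psi>: "\<And>x. x \<in> S \<Longrightarrow> (\<psi> has_real_derivative \<psi>' x) (at x)"
    and nz: "\<And>x. x \<in> S \<Longrightarrow> \<psi>' x \<noteq> 0"
    and c: "\<And>x. x \<in> S \<Longrightarrow>
      (c has_vector_derivative (\<psi>' x * \<rho> x) *\<^sub>R unit_tangent (\<psi> x)) (at x)"
  shows "has_signed_radius_on c \<psi> \<rho> S"
  unfolding has_signed_radius_on_def
proof (intro conjI ballI)
  show inj: "inj_on \<psi> S"
    using assms(2) \<psi> nz by (rule inj_on_nonzero_deriv)
  fix x assume x: "x \<in> S"
  have "continuous_on S \<psi>"
    using \<psi> by (meson DERIV_isCont continuous_at_imp_continuous_on)
  moreover have "(\<psi> has_derivative (\<lambda>h. h * \<psi>' x)) (at x)"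
    using \<psi>[OF x] by (simp only: has_real_derivative_iff_has_vector_derivative has_vector_derivative_def real_scaleR_def)
  \<comment> \<open>The inverse function theorem used here takes derivatives as linear maps and
    needs a right inverse of the one of \<psi>.\<close>
  moreover have "(\<lambda>h. h * \<psi>' x) \<circ> (\<lambda>h. h * inverse (\<psi>' x)) = id"
    using nz[OF x] by (simp add: fun_eq_iff)
  ultimately have "(inv_into S \<psi> has_derivative (\<lambda>h. h * inverse (\<psi>' x))) (at (\<psi> x))"
    using has_derivative_inverse_strong[OF \<open>open S\<close> x] inv_into_f_f[OF inj] by blast
  then have "(inv_into S \<psi> has_vector_derivative inverse (\<psi>' x)) (at (\<psi> x))"
    by (simp only: has_vector_derivative_def real_scaleR_def)
  moreover have "(c has_vector_derivative (\<psi>' x * \<rho> x) *\<^sub>R unit_tangent (\<psi> x))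
      (at (inv_into S \<psi> (\<psi> x)))"
    using c x inj by (simp add: inv_into_f_f)
  ultimately have "((c \<circ> inv_into S \<psi>) has_vector_derivative
      inverse (\<psi>' x) *\<^sub>R (\<psi>' x * \<rho> x) *\<^sub>R unit_tangent (\<psi> x)) (at (\<psi> x))"
    by (rule vector_diff_chain_at)
  then show "((c \<circ> inv_into S \<psi>) has_vector_derivative \<rho> x *\<^sub>R unit_tangent (\<psi> x)) (at (\<psi> x))"
    using nz[OF x] by (simp flip: mult.assoc)
qed

lemma smooth_onD:
  assumes "smooth_on S f" "x \<in> S"
  shows "(f has_real_derivative deriv f x) (at x)"
    and "(deriv f has_real_derivative deriv (deriv f) x) (at x)"
proof -
  have *: "((deriv ^^ k) f) differentiable (at x)" for k
    using assms by (simp add: smooth_on_def)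
  show "(f has_real_derivative deriv f x) (at x)"
    using *[of 0] by (simp add: DERIV_deriv_iff_real_differentiable)
  show "(deriv f has_real_derivative deriv (deriv f) x) (at x)"
    using *[of 1] by (simp add: DERIV_deriv_iff_real_differentiable)
qed

lemma has_vector_derivative_ray_direction:
  assumes "(\<phi> has_real_derivative d) (at \<theta>)"
  shows "(ray_direction \<phi> has_vector_derivative (1 - d) *\<^sub>R unit_normal (\<theta> + pi / 2 - \<phi> \<theta>)) (at \<theta>)"
proof -
  have "((\<lambda>x. x + pi / 2 - \<phi> x) has_real_derivative 1 - d) (at \<theta>)"
    using assms by (auto intro!: derivative_eq_intros)
  from has_vector_derivative_unit_tangent[OF this] show ?thesis
    by (simp add: ray_direction_eq[abs_def])
qed

text \<open>The component along N(\<psi>) of the velocity for fixed \<open>t\<close> is t(1 - d) -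
  \<rho> cos \<phi>, which has exactly one zero in \<open>t\<close> because d differs from 1. This
  uniqueness gives the \<open>THE\<close> in \<open>caustic\<close> its value.\<close>

lemma envelope_condition_iff:
  assumes r: "(r has_vector_derivative \<rho> *\<^sub>R unit_tangent \<theta>) (at \<theta>)"
    and \<phi>: "(\<phi> has_real_derivative d) (at \<theta>)" and "d \<noteq> 1"
  shows "envelope_condition r (ray_direction \<phi>) \<theta> t \<longleftrightarrow> t = \<rho> * cos (\<phi> \<theta>) / (1 - d)"
proof -
  let ?\<psi> = "\<theta> + pi / 2 - \<phi> \<theta>"
  have "((\<lambda>x. r x + t *\<^sub>R ray_direction \<phi> x) has_vector_derivative
      \<rho> *\<^sub>R unit_tangent \<theta> + t *\<^sub>R (1 - d) *\<^sub>R unit_normal ?\<psi>) (at \<theta>)"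
    using r has_vector_derivative_ray_direction[OF \<phi>]
    by (auto intro!: derivative_eq_intros)
  moreover have "((\<lambda>s. r \<theta> + s *\<^sub>R ray_direction \<phi> \<theta>) has_vector_derivative ray_direction \<phi> \<theta>) (at t)"
    by (auto intro!: derivative_eq_intros)
  ultimately have "envelope_condition r (ray_direction \<phi>) \<theta> t \<longleftrightarrow>
      (\<rho> *\<^sub>R unit_tangent \<theta> + t *\<^sub>R (1 - d) *\<^sub>R unit_normal ?\<psi>) \<bullet> unit_normal ?\<psi> = 0"
    by (simp add: envelope_condition_def vector_derivative_at ray_direction_eq
        collinear_unit_tangent_iff)
  also have "\<dots> \<longleftrightarrow> t * (1 - d) = \<rho> * cos (\<phi> \<theta>)"
    by (subst unit_tangent_eq_ray_frame[of \<theta> "\<phi> \<theta>"])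
      (auto simp: inner_add_left inner_diff_left)
  finally show ?thesis
    using \<open>d \<noteq> 1\<close> by (simp add: field_simps)
qed

text \<open>The coefficient is kept as the product of d\<psi>/d\<theta> and the claimed radius, the
  shape that \<open>has_signed_radius_onI\<close> expects.\<close>

lemma has_vector_derivative_caustic:
  assumes "open I" "\<theta> \<in> I" and R: "smooth_on I R" and \<phi>: "smooth_on I \<phi>"
    and r: "\<forall>\<theta>\<in>I. (r has_vector_derivative R \<theta> *\<^sub>R unit_tangent \<theta>) (at \<theta>)"
    and ne: "\<forall>\<theta>\<in>I. deriv \<phi> \<theta> \<noteq> 1"
  shows "(caustic r (ray_direction \<phi>) has_vector_derivative
      ((1 - deriv \<phi> \<theta>) * (1 / (1 - deriv \<phi> \<theta>)\<^sup>2 *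
           (((1 - 2 * deriv \<phi> \<theta>) * sin (\<phi> \<theta>)
              + deriv (deriv \<phi>) \<theta> / (1 - deriv \<phi> \<theta>) * cos (\<phi> \<theta>)) * R \<theta>
            + cos (\<phi> \<theta>) * deriv R \<theta>))) *\<^sub>R unit_tangent (\<theta> + pi / 2 - \<phi> \<theta>)) (at \<theta>)"
    (is "(_ has_vector_derivative ?k *\<^sub>R unit_tangent ?\<psi>) _")
proof -
  define t where "t = (\<lambda>x. R x * cos (\<phi> x) / (1 - deriv \<phi> x))"
  \<comment> \<open>The quotient rule for \<open>t\<close>; the \<phi>'' term is positive because
    the denominator 1 - \<phi>' has derivative -\<phi>''.\<close>
  define t' where "t' = ((deriv R \<theta> * cos (\<phi> \<theta>) - R \<theta> * (sin (\<phi> \<theta>) * deriv \<phi> \<theta>)) * (1 - deriv \<phi> \<theta>)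
      + R \<theta> * cos (\<phi> \<theta>) * deriv (deriv \<phi>) \<theta>) / ((1 - deriv \<phi> \<theta>) * (1 - deriv \<phi> \<theta>))"
  have nz: "1 - deriv \<phi> \<theta> \<noteq> 0"
    using ne \<open>\<theta> \<in> I\<close> by auto
  have "(t has_real_derivative t') (at \<theta>)"
    unfolding t_def t'_def
    using nz by (auto intro!: derivative_eq_intros smooth_onD[OF R \<open>\<theta> \<in> I\<close>] smooth_onD[OF \<phi> \<open>\<theta> \<in> I\<close>]
        simp: algebra_simps)
  then have "((\<lambda>x. r x + t x *\<^sub>R ray_direction \<phi> x) has_vector_derivative
      R \<theta> *\<^sub>R unit_tangent \<theta> +
      (t \<theta> *\<^sub>R (1 - deriv \<phi> \<theta>) *\<^sub>R unit_normal ?\<psi> + t' *\<^sub>R ray_direction \<phi> \<theta>)) (at \<theta>)"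
    using r \<open>\<theta> \<in> I\<close> has_vector_derivative_ray_direction[OF smooth_onD(1)[OF \<phi> \<open>\<theta> \<in> I\<close>]]
    by (intro has_vector_derivative_add has_vector_derivative_scaleR) auto
  \<comment> \<open>The formula holds at every point of the open set \<open>I\<close>, not only at
    \<theta>, so the derivative carries over to the caustic.\<close>
  moreover have "caustic r (ray_direction \<phi>) x = r x + t x *\<^sub>R ray_direction \<phi> x" if "x \<in> I" for x
    using envelope_condition_iff[OF r[rule_format, OF that] smooth_onD(1)[OF \<phi> that]] ne that
    by (simp add: caustic_def t_def)
  ultimately have D: "(caustic r (ray_direction \<phi>) has_vector_derivative
      R \<theta> *\<^sub>R unit_tangent \<theta> +
      (t \<theta> *\<^sub>R (1 - deriv \<phi> \<theta>) *\<^sub>R unit_normal ?\<psi> + t' *\<^sub>R ray_direction \<phi> \<theta>)) (at \<theta>)"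
    using \<open>open I\<close> \<open>\<theta> \<in> I\<close>
    by (auto intro: has_vector_derivative_transform_within_open)
  \<comment> \<open>The choice of \<open>t\<close> makes the components along N(\<psi>) cancel, so
    the velocity lies along the ray.\<close>
  have "R \<theta> *\<^sub>R unit_tangent \<theta> +
      (t \<theta> *\<^sub>R (1 - deriv \<phi> \<theta>) *\<^sub>R unit_normal ?\<psi> + t' *\<^sub>R ray_direction \<phi> \<theta>)
      = (R \<theta> * sin (\<phi> \<theta>) + t') *\<^sub>R unit_tangent ?\<psi>"
    using nz by (subst unit_tangent_eq_ray_frame[of \<theta> "\<phi> \<theta>"])
      (simp add: t_def ray_direction_eq scaleR_add_left scaleR_diff_right)
  \<comment> \<open>The factor 1 - 2\<phi>' arises from R sin \<phi> together with the term -R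
    \<phi>' sin \<phi> / (1 - \<phi>') of \<open>t'\<close>.\<close>
  also have "R \<theta> * sin (\<phi> \<theta>) + t' = ?k"
    unfolding t'_def using nz by (simp add: divide_simps power2_eq_square) algebra
  finally show ?thesis
    using D by simp
qed

theorem theorem1:
  fixes I :: "real set"
    and r :: "real \<Rightarrow> real \<times> real"
    and R \<phi> :: "real \<Rightarrow> real"
  assumes "open I" and "is_interval I" and "I \<noteq> {}"
    and "smooth_on I R" and "smooth_on I \<phi>"
    and "\<forall>\<theta>\<in>I. (r has_vector_derivative R \<theta> *\<^sub>R unit_tangent \<theta>) (at \<theta>)"
    and "\<forall>\<theta>\<in>I. deriv \<phi> \<theta> \<noteq> 1"
  shows "(\<forall>\<theta>\<in>I. \<exists>!t. envelope_condition r (ray_direction \<phi>) \<theta> t)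
    \<and> (\<forall>\<theta>\<in>I. caustic r (ray_direction \<phi>) differentiable (at \<theta>)
          \<and> collinear {0, vector_derivative (caustic r (ray_direction \<phi>)) (at \<theta>), ray_direction \<phi> \<theta>})
    \<and> (\<forall>\<theta>\<in>I. \<forall>\<alpha>. is_inclination \<alpha> (ray_direction \<phi> \<theta>)
          \<longleftrightarrow> (\<exists>k::int. \<alpha> = \<theta> + pi / 2 - \<phi> \<theta> + 2 * pi * of_int k))
    \<and> has_signed_radius_on (caustic r (ray_direction \<phi>))
        (\<lambda>\<theta>. \<theta> + pi / 2 - \<phi> \<theta>)
        (\<lambda>\<theta>. 1 / (1 - deriv \<phi> \<theta>)\<^sup>2 *
           (((1 - 2 * deriv \<phi> \<theta>) * sin (\<phi> \<theta>)
              + deriv (deriv \<phi>) \<theta> / (1 - deriv \<phi> \<theta>) * cos (\<phi> \<theta>)) * R \<theta>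
            + cos (\<phi> \<theta>) * deriv R \<theta>))
        I"
proof -
  note r = assms(6)[rule_format]
  have D\<psi>: "((\<lambda>\<theta>. \<theta> + pi / 2 - \<phi> \<theta>) has_real_derivative 1 - deriv \<phi> \<theta>) (at \<theta>)"
    if "\<theta> \<in> I" for \<theta>
    using smooth_onD(1)[OF assms(5) that] by (auto intro!: derivative_eq_intros)
  note Dc = has_vector_derivative_caustic[OF assms(1) _ assms(4-7)]
  have "\<exists>!t. envelope_condition r (ray_direction \<phi>) \<theta> t" if "\<theta> \<in> I" for \<theta>
    using envelope_condition_iff[OF r[OF that] smooth_onD(1)[OF assms(5) that]] assms(7) that
    by simp
  \<comment> \<open>Tangency is stated as collinearity with 0, which also covers points where the
    caustic has zero velocity.\<close>
  moreover have "caustic r (ray_direction \<phi>) differentiable (at \<theta>)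
      \<and> collinear {0, vector_derivative (caustic r (ray_direction \<phi>)) (at \<theta>), ray_direction \<phi> \<theta>}"
    if "\<theta> \<in> I" for \<theta>
    using Dc[OF that]
    by (auto simp: vector_derivative_at ray_direction_eq collinear_unit_tangent_iff
        intro: differentiableI_vector)
  \<comment> \<open>Sine and cosine together determine an angle up to multiples of 2 pi.\<close>
  moreover have "is_inclination \<alpha> (ray_direction \<phi> \<theta>)
      \<longleftrightarrow> (\<exists>k::int. \<alpha> = \<theta> + pi / 2 - \<phi> \<theta> + 2 * pi * of_int k)" for \<alpha> \<theta>
    using sin_cos_eq_iff[of \<alpha> "\<theta> + pi / 2 - \<phi> \<theta>"]
    by (auto simp: is_inclination_def ray_direction_eq unit_tangent_def)
  ultimately show ?thesis
    using has_signed_radius_onI[OF assms(1,2) D\<psi> _ Dc] assms(7) by auto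
qed

end
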